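(* Let $k\ge2$, $0<\lambda<1$, let $\mathcal T$ be a finite set with $|\mathcal T|>k$, and let $\mathcal S=\mathrm{ALG1}(\mathcal T\mid k,\lambda)$ be the $k$-element set selected by the greedy algorithm described in the context. Let $t\in\mathcal T\setminus\mathcal S$. Then $$\Delta(t,\mathcal S):=Q(\mathcal S\cup\{t\})-Q(\mathcal S)\ \le\ \frac1{k\lambda}F(\mathcal S)$$ and $$\min_{z\in\mathcal S}d(t,z)\ \le\ \frac{2.5}{k(k-1)(1-\lambda)}F(\mathcal S).$$
   Context: $q:\mathcal T\to[0,\infty)$ is a quality function and $d$ is a metric on $\mathcal T$. For finite $\mathcal S$, $Q(\mathcal S)=\sum_{u\in\mathcal S}q(u)$, $D(\mathcal S)=\sum_{u,v\in\mathcal S}d(u,v)$ (sum over ordered pairs), and $F(\mathcal S)=\lambda Q(\mathcal S)+(1-\lambda)D(\mathcal S)$. Greedy selection $\mathrm{ALG1}(\mathcal T\mid k,\lambda)$: start with $\mathcal S=\{\arg\max_{t\in\mathcal T}q(t)\}$; then, $k-1$ times, add to $\mathcal S$ an element $t\in\mathcal T\setminus\mathcal S$ maximizing $\lambda q(t)+(1-\lambda)\sum_{u\in\mathcal S}d(t,u)$. Ties are broken arbitrarily. *)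

theory Defs
  imports "HOL-Analysis.Analysis"
begin

definition quality :: "('a \<Rightarrow> real) \<Rightarrow> 'a set \<Rightarrow> real" where
  "quality q S = (\<Sum>u\<in>S. q u)"

text \<open>Every unordered pair of distinct elements is counted twice.\<close>

definition diversity :: "('a \<Rightarrow> 'a \<Rightarrow> real) \<Rightarrow> 'a set \<Rightarrow> real" where
  "diversity d S = (\<Sum>(u, v)\<in>S \<times> S. d u v)"

definition objective ::
  "('a \<Rightarrow> real) \<Rightarrow> ('a \<Rightarrow> 'a \<Rightarrow> real) \<Rightarrow> real \<Rightarrow> 'a set \<Rightarrow> real" where
  "objective q d lam S = lam * quality q S + (1 - lam) * diversity d S"

definition marginal_quality :: "('a \<Rightarrow> real) \<Rightarrow> 'a \<Rightarrow> 'a set \<Rightarrow> real" where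
  "marginal_quality q t S = quality q (S \<union> {t}) - quality q S"

text \<open>
  \<open>ALG1 q d T lam k S\<close> holds if some run of the greedy selection on \<open>T\<close> with
  parameters \<open>k\<close> and \<open>lam\<close> returns \<open>S\<close>.  It is a relation because ties are broken arbitrarily.
\<close>

inductive ALG1 ::
  "('a \<Rightarrow> real) \<Rightarrow> ('a \<Rightarrow> 'a \<Rightarrow> real) \<Rightarrow> 'a set \<Rightarrow> real \<Rightarrow> nat \<Rightarrow> 'a set \<Rightarrow> bool"
  for q d T lam where
  init: "is_arg_max q (\<lambda>t. t \<in> T) s \<Longrightarrow> ALG1 q d T lam 1 {s}"
| step: "ALG1 q d T lam k S \<Longrightarrow>
    is_arg_max (\<lambda>t. lam * q t + (1 - lam) * (\<Sum>u\<in>S. d t u)) (\<lambda>t. t \<in> T - S) s \<Longrightarrow>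
    ALG1 q d T lam (Suc k) (insert s S)"

end

theory Submission
  imports Defs
begin

text \<open>
  If \<open>t\<close> is never selected, then at each step the selected element has greedy value at least that
  of \<open>t\<close>. When \<open>t\<close> is at distance at least \<open>m\<close> from \<open>S\<close>, the value of \<open>t\<close> after \<open>i\<close> selections is
  at least \<open>\<lambda> q(t) + (1 - \<lambda>) i m\<close>, and the increase of \<open>F\<close> dominates the greedy value of the selected
  element. Summing over \<open>i < k\<close> gives \<open>k \<lambda> q(t) + (1 - \<lambda>) m k (k - 1) / 2 \<le> F(S)\<close>.
  The choices \<open>m = 0\<close> and \<open>m = min d(t, z)\<close> yield the two bounds, the second one even
  with the constant 2 in place of 2.5.
\<close>

lemma diversity_insert:
  assumes "finite S" and "s \<notin> S" and "d s s = 0" and "\<And>u. d u s = d s u"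
  shows "diversity d (insert s S) = diversity d S + 2 * (\<Sum>u\<in>S. d s u)"
proof -
  have "diversity d (insert s S) = (\<Sum>u\<in>insert s S. \<Sum>v\<in>insert s S. d u v)"
    by (simp add: diversity_def sum.cartesian_product)
  also have "\<dots> = (\<Sum>u\<in>S. d s u) + (\<Sum>u\<in>S. d u s) + (\<Sum>u\<in>S. \<Sum>v\<in>S. d u v)"
    using assms(1-3) by (simp add: sum.distrib)
  also have "(\<Sum>u\<in>S. d u s) = (\<Sum>u\<in>S. d s u)"
    by (intro sum.cong refl assms(4))
  finally show ?thesis
    by (simp add: diversity_def sum.cartesian_product)
qed

text \<open>Ordered pairs count each new distance twice, whereas the greedy value of
  \<open>s\<close> counts it once.\<close>

lemma objective_insert:
  assumes "finite S" and "s \<notin> S" and "d s s = 0" and "\<And>u. d u s = d s u"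
  shows "objective q d lam (insert s S) =
    objective q d lam S + lam * q s + 2 * (1 - lam) * (\<Sum>u\<in>S. d s u)"
  using assms(1,2) diversity_insert[of S s d, OF assms]
  by (simp add: objective_def quality_def algebra_simps)

lemma ALG1_subset_card:
  assumes "ALG1 q d T lam k S"
  shows "S \<subseteq> T \<and> finite S \<and> card S = k"
  using assms by induction (auto simp: is_arg_max_def)

text \<open>\<open>m\<close> stays free so that one induction serves both bounds. The hypotheses on
  \<open>t\<close> and \<open>m\<close> pass to subsets of \<open>S\<close>, so they hold at every
  earlier stage of the run.\<close>

lemma ALG1_objective_ge:
  assumes "ALG1 q d T lam k S" and M: "Metric_space T d" and lam: "0 \<le> lam" "lam \<le> 1"
    and "t \<in> T - S" and "\<And>z. z \<in> S \<Longrightarrow> m \<le> d t z"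
  shows "real k * (lam * q t) + (1 - lam) * m * (real k * (real k - 1) / 2) \<le> objective q d lam S"
  using assms(1,5,6)
proof induction
  case (init s)
  then have s: "s \<in> T" "q t \<le> q s" and "d s s = 0"
    using Metric_space.mdist_zero[OF M] by (auto simp: is_arg_max_def not_less)
  \<comment> \<open>For \<open>k = 1\<close> the quadratic term vanishes, and so does the diversity
    of a singleton.\<close>
  then show ?case
    using lam by (simp add: objective_def quality_def diversity_def mult_left_mono)
next
  case (step k S s)
  have S: "finite S" "card S = k"
    using ALG1_subset_card[OF step.hyps(1)] by auto
  have s: "s \<in> T" "s \<notin> S"
    and greedy: "lam * q t + (1 - lam) * (\<Sum>u\<in>S. d t u) \<le> lam * q s + (1 - lam) * (\<Sum>u\<in>S. d s u)"
    using step.hyps(2) step.prems(1) by (auto simp: is_arg_max_def not_less)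
  have "real k * m \<le> (\<Sum>u\<in>S. d t u)"
    using sum_bounded_below[of S m "d t"] step.prems(2) S by simp
  then have "(1 - lam) * (real k * m) \<le> (1 - lam) * (\<Sum>u\<in>S. d t u)"
    using lam by (intro mult_left_mono) auto
  \<comment> \<open>The objective grows by the greedy value of \<open>s\<close> plus one more copy
    of this term, which can thus be dropped.\<close>
  moreover have "0 \<le> (1 - lam) * (\<Sum>u\<in>S. d s u)"
    using lam by (intro mult_nonneg_nonneg sum_nonneg) (auto simp: Metric_space.nonneg[OF M])
  moreover have "objective q d lam (insert s S) =
      objective q d lam S + lam * q s + 2 * (1 - lam) * (\<Sum>u\<in>S. d s u)"
    using S s Metric_space.mdist_zero[OF M] Metric_space.commute[OF M]
    by (intro objective_insert) auto
  moreover have "real k * (lam * q t) + (1 - lam) * m * (real k * (real k - 1) / 2)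
      \<le> objective q d lam S"
    using step.IH step.prems by auto
  \<comment> \<open>The \<open>k\<close> distances from \<open>t\<close> to \<open>S\<close> raise
    the coefficient from \<open>k * (k - 1) / 2\<close> to \<open>(k + 1) * k / 2\<close>.\<close>
  ultimately show ?case
    using greedy by (simp add: field_simps)
qed

theorem lemma1:
  fixes T S :: "'a set" and q :: "'a \<Rightarrow> real" and d :: "'a \<Rightarrow> 'a \<Rightarrow> real"
    and lam :: real and k :: nat and t :: 'a
  assumes "Metric_space T d"
    and "\<And>u. u \<in> T \<Longrightarrow> q u \<ge> 0"
    and "k \<ge> 2"
    and "0 < lam" and "lam < 1"
    and "finite T" and "card T > k"
    and "ALG1 q d T lam k S"
    and "t \<in> T - S"
  shows "marginal_quality q t S \<le> 1 / (real k * lam) * objective q d lam S \<and>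
    Min (d t ` S) \<le> 2.5 / (real k * (real k - 1) * (1 - lam)) * objective q d lam S"
proof
  have S: "finite S"
    using ALG1_subset_card[OF assms(8)] by auto
  have qt: "0 \<le> real k * (lam * q t)"
    using assms by simp
  have *: "real k * (lam * q t) \<le> objective q d lam S"
    using ALG1_objective_ge[OF assms(8,1) _ _ assms(9), of 0] assms(4,5)
    by (simp add: Metric_space.nonneg[OF assms(1)])
  have "marginal_quality q t S = q t"
    using S assms(9) by (simp add: marginal_quality_def quality_def)
  then show "marginal_quality q t S \<le> 1 / (real k * lam) * objective q d lam S"
    using * assms(3,4) by (simp add: field_simps)
  have "real k * (lam * q t) + (1 - lam) * Min (d t ` S) * (real k * (real k - 1) / 2)
      \<le> objective q d lam S"
    using ALG1_objective_ge[OF assms(8,1) _ _ assms(9), of "Min (d t ` S)"] assms(4,5) S by simp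
  moreover have "Min (d t ` S) * (real k * (real k - 1) * (1 - lam)) =
      2 * ((1 - lam) * Min (d t ` S) * (real k * (real k - 1) / 2))"
    by simp
  \<comment> \<open>Relaxing the factor 2 to 2.5 uses that the objective is nonnegative, by
    \<open>qt\<close> and \<open>*\<close>.\<close>
  ultimately have "Min (d t ` S) * (real k * (real k - 1) * (1 - lam)) \<le> 2.5 * objective q d lam S"
    using qt * by linarith
  moreover have "0 < real k * (real k - 1) * (1 - lam)"
    using assms(3,5) by simp
  ultimately show "Min (d t ` S) \<le> 2.5 / (real k * (real k - 1) * (1 - lam)) * objective q d lam S"
    by (simp add: pos_le_divide_eq)
qed

end
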